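(* Let the infinite sequence $\{(x_k,u_k)\}$ be generated by the method B-STEP-DCA described in the context, let the sequence of penalty parameters $\{c_k\}$ be bounded, and let $\sum_{k=0}^\infty\nu_k<+\infty$. Suppose also that the function $H_0(x,u,t)$ is strongly convex in $(x,u)$ with modulus $\mu>0$ for a.e. $t\in[0,T]$. Then $$\sum_{k=0}^\infty\|(x_{k+1}-x_k,u_{k+1}-u_k)\|_2^2<+\infty.$$ In particular, $\|x_{k+1}-x_k\|_2\to0$ and $\|u_{k+1}-u_k\|_2\to0$ as $k\to\infty$.
   Context: Notation. $T>0$; $|\cdot|$ is the Euclidean norm; $\mathbb N=\{0,1,2,\dots\}$; $\|\cdot\|_s$ is the $L^s$ norm on $[0,T]$, and $\|(x,u)\|_2^2=\int_0^T(|x(t)|^2+|u(t)|^2)\,dt$; $W^{1,s}([0,T];\mathbb R^n)$ is the space of absolutely continuous $x$ with $\dot x\in L^s$, normed by $\|x\|_{1,s}=\|x\|_s+\|\dot x\|_s$. $X=W^{1,\infty}([0,T];\mathbb R^n)\times L^\infty([0,T];\mathbb R^m)$ with norm $\|x\|_{1,\infty}+\|u\|_\infty$; $Y=W^{1,1}([0,T];\mathbb R^n)\times L^1([0,T];\mathbb R^m)$ with norm $\|x\|_{1,1}+\|u\|_1$. $X_0\subseteq X$ is a convex set closed in $X$ with respect to the topology of $Y$. $\partial$ is the convex subdifferential, $\partial_{x,u}$ the one with respect to $(x,u)$. A function $f$ is strongly convex with modulus $\mu$ if $f-\frac\mu2|\cdot|^2$ is convex. A point $z\in X_0$ is $\varepsilon$-optimal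 for minimising $f$ over $X_0$ if $f(z)\le\inf_{X_0}f+\varepsilon$. Problem $(\mathcal P)$: minimise $J(x,u)=\int_0^TF_0(x(t),u(t),t)\,dt+f_0(x(0),x(T))$ over $(x,u)\in X_0$ subject to $\dot x(t)=F(x(t),u(t),t)$ for a.e. $t$; $f_i(x(0),x(T))\le0$, $i\in\mathcal I=\{1,\dots,\ell_I\}$; $f_j(x(0),x(T))=0$, $j\in\mathcal E=\{\ell_I+1,\dots,\ell_E\}$; $\Xi_s(x(t),u(t),t)\le0$ for a.e. $t$, $s\in\mathcal M=\{1,\dots,\ell_M\}$ (index sets may be empty). Here $F_0=G_0-H_0$, $F=G-H$ ($\mathbb R^n$-valued, components $F_i=G_i-H_i$, $i=1,\dots,n$), $f_i=g_i-h_i$ on $\mathbb R^{2n}$, $\Xi_s=p_s-q_s$, where $G_i,H_i$ ($0\le i\le n$), $p_s,q_s$ are real-valued functions of $(x,u,t)\in\mathbb R^n\times\mathbb R^m\times[0,T]$ convex in $(x,u)$, and $g_i,h_i$ are real-valued convex functions (possibly nonsmooth). Data assumptions. $G_i,H_i$ ($0\le i\le n$), $p_s,q_s$ are Carathéodory (continuous in $(x,u)$ for a.e. $t$, measurable in $t$); for every $(x,u)\in X$ the multifunctions $t\mapsto\partial_{x,u}G_i(x(t),u(t),t)$, and likewise for $H_i,p_s,q_s$, are measurable; for every $R>0$ there is $\gamma_R>0$ such that for a.e. $t$ and all $(x,u)$ with $|x|+|u|\le R$ the absolute values of all these functions at $(x,u,t)$, and the norms of all their subgradients in $(x,u)$ there,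 are at most $\gamma_R$. Penalty function. $\Phi_c=J+c\varphi$, $\varphi(x,u)=\sum_{i=1}^n\int_0^T|\dot x_i(t)-F_i(x(t),u(t),t)|\,dt+\sum_{i\in\mathcal I}\max\{0,f_i(x(0),x(T))\}+\sum_{j\in\mathcal E}|f_j(x(0),x(T))|+\sum_{s\in\mathcal M}\int_0^T\max\{0,\Xi_s(x(t),u(t),t)\}\,dt$. Convex majorants. A collection of subgradients at $(\bar x,\bar u)\in X$ is $V=(V_0,\dots,V_n,W_1,\dots,W_n,v_0,\dots,v_{\ell_E},w_{\ell_I+1},\dots,w_{\ell_E},z_1,\dots,z_{\ell_M})$ with $V_i,W_i,z_s$ measurable on $[0,T]$ and, for a.e. $t$, $V_i(t)\in\partial_{x,u}H_i(\bar x(t),\bar u(t),t)$, $W_i(t)\in\partial_{x,u}G_i(\bar x(t),\bar u(t),t)$, $z_s(t)\in\partial_{x,u}q_s(\bar x(t),\bar u(t),t)$, $v_i\in\partial h_i(\bar x(0),\bar x(T))$, $w_j\in\partial g_j(\bar x(0),\bar x(T))$. With $\Delta(t)=(x(t)-\bar x(t),u(t)-\bar u(t))$, $\Delta_b=(x(0)-\bar x(0),x(T)-\bar x(T))$, put $\Gamma(x,u;\bar x,\bar u;V)=\sum_{i=1}^n\int_0^T\max\{\dot x_i+H_i(x,u,t)-G_i(\bar x,\bar u,t)-\langle W_i,\Delta\rangle,\,-\dot x_i+G_i(x,u,t)-H_i(\bar x,\bar u,t)-\langle V_i,\Delta\rangle\}\,dt+\sum_{i\in\mathcal I}\max\{0,g_i(x(0),x(T))-h_i(\bar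 x(0),\bar x(T))-\langle v_i,\Delta_b\rangle\}+\sum_{j\in\mathcal E}\max\{g_j(x(0),x(T))-h_j(\bar x(0),\bar x(T))-\langle v_j,\Delta_b\rangle,\,h_j(x(0),x(T))-g_j(\bar x(0),\bar x(T))-\langle w_j,\Delta_b\rangle\}+\sum_{s\in\mathcal M}\int_0^T\max\{0,p_s(x,u,t)-q_s(\bar x,\bar u,t)-\langle z_s,\Delta\rangle\}\,dt$ (functions under integrals evaluated at $t$), $\omega(x,u;V)=\int_0^T(G_0(x(t),u(t),t)-\langle V_0(t),(x(t),u(t))\rangle)\,dt+g_0(x(0),x(T))-\langle v_0,(x(0),x(T))\rangle$, and $Q_c(x,u;\bar x,\bar u;V)=\omega(x,u;V)+c\,\Gamma(x,u;\bar x,\bar u;V)$. Method B-STEP-DCA. Choose $(x_0,u_0)\in X_0$, $c_0>0$, $\eta_1,\eta_2,\zeta,\sigma\in(0,1)$, $\varepsilon_\varphi,\varepsilon_{feas}>0$, $\{\varepsilon_k\}\subset(0,\infty)$. For iteration $k=0,1,\dots$: pick a collection of subgradients $V_k$ at $(x_k,u_k)$; write $\Gamma_k(\cdot)=\Gamma(\cdot;x_k,u_k;V_k)$, $\omega_k(\cdot)=\omega(\cdot;V_k)$, $Q_{c,k}=\omega_k+c\Gamma_k$; $(x_k[c],u_k[c])$ denotes a computed $\varepsilon_k$-optimal solution of $\min_{X_0}Q_{c,k}$. Step 1: $c_+=c_k$; compute $(x_k[c_+],u_k[c_+])$; if $\Gamma_k(x_k[c_+],u_k[c_+])\le\varepsilon_\varphi$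 go to Step 4, else to Step 2. Step 2: compute an $\varepsilon_k$-optimal solution $(\widehat x_k,\widehat u_k)$ of $\min_{X_0}\Gamma_k$. If $\Gamma_k(\widehat x_k,\widehat u_k)<\Gamma_k(x_k,u_k)$ go to Step 3. Otherwise, while $\Gamma_k(x_k[c_+],u_k[c_+])\le\Gamma_k(x_k,u_k)+\varepsilon_{feas}$ fails, increase $c_+$ and recompute $(x_k[c_+],u_k[c_+])$; then go to Step 4. Step 3: while $\Gamma_k(x_k[c_+],u_k[c_+])-\Gamma_k(x_k,u_k)\le\eta_1(\Gamma_k(\widehat x_k,\widehat u_k)-\Gamma_k(x_k,u_k))$ fails, increase $c_+$ and recompute; then go to Step 4. Step 4: put $c_{k+1}=c_+$; while $Q_{c_{k+1},k}(x_k[c_{k+1}],u_k[c_{k+1}])-Q_{c_{k+1},k}(x_k,u_k)\le c_{k+1}\eta_2(\Gamma_k(x_k[c_{k+1}],u_k[c_{k+1}])-\Gamma_k(x_k,u_k))$ fails, increase $c_{k+1}$ and recompute. Step 5: with $d_k=(x_k[c_{k+1}]-x_k,u_k[c_{k+1}]-u_k)$, choose $\nu_k>0$, $\overline\alpha_k\ge0$, find the smallest $j_k\in\mathbb N$ such that, for $\alpha_k=\zeta^{j_k}\overline\alpha_k$, $\Phi_{c_{k+1}}((x_k[c_{k+1}],u_k[c_{k+1}])+\alpha_kd_k)-\Phi_{c_{k+1}}(x_k[c_{k+1}],u_k[c_{k+1}])\le-\sigma\alpha_k^2\|d_k\|_2^2+\nu_k$; set $(x_{k+1},u_{k+1})=(x_k[c_{k+1}],u_k[c_{k+1}])+\alpha_kd_k$.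 (No stopping criterion is applied, so the sequence is infinite.) Standing assumptions on the method. All computed points $(x_k[c],u_k[c])$ satisfy $Q_{c,k}(x_k[c],u_k[c])\le Q_{c,k}(x_k,u_k)$. The trial step $\overline\alpha_k$ is such that $(x_k[c_{k+1}],u_k[c_{k+1}])+\zeta^j\overline\alpha_kd_k\in X_0$ for all $j\in\mathbb N$. $\Phi_{c_0}$ is bounded below on $X_0$. There is $\varkappa>0$ such that whenever $c_+$ or $c_{k+1}$ is increased in Steps 2, 3, 4, it is increased by at least $\varkappa$. *)

theory Defs
  imports "HOL-Analysis.Analysis"
begin

section \<open>Function spaces on a compact interval\<close>

text \<open>
  Elements of the spaces below are represented by functions on the real line of which only the
  restriction to \<open>{0..T}\<close> matters. Elements of \<open>L\<^sup>s\<close> are not quotiented by equality almost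
  everywhere, so the norms are seminorms on representatives. The first component of a pair is the
  state \<open>x\<close>, the second one the control \<open>u\<close>.
\<close>

type_synonym ('n, 'm) traj = "(real \<Rightarrow> real^'n) \<times> (real \<Rightarrow> real^'m)"

abbreviation traj_lin ::
    "real \<Rightarrow> ('n::finite, 'm::finite) traj \<Rightarrow> real \<Rightarrow> ('n, 'm) traj \<Rightarrow> ('n, 'm) traj" where
  "traj_lin a z b w \<equiv>
     ((\<lambda>t. a *\<^sub>R fst z t + b *\<^sub>R fst w t), (\<lambda>t. a *\<^sub>R snd z t + b *\<^sub>R snd w t))"

abbreviation traj_diff ::
    "('n::finite, 'm::finite) traj \<Rightarrow> ('n, 'm) traj \<Rightarrow> ('n, 'm) traj" where
  "traj_diff z w \<equiv> ((\<lambda>t. fst z t - fst w t), (\<lambda>t. snd z t - snd w t))"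

definition traj_at :: "('n::finite, 'm::finite) traj \<Rightarrow> real \<Rightarrow> (real^'n) \<times> (real^'m)" where
  "traj_at z t = (fst z t, snd z t)"

definition traj_ends :: "real \<Rightarrow> ('n::finite, 'm::finite) traj \<Rightarrow> (real^'n) \<times> (real^'n)" where
  "traj_ends T z = (fst z 0, fst z T)"

text \<open>A pair \<open>(a, b)\<close> in \<open>D\<close> stands for the interval with endpoints \<open>a \<le> b\<close>.\<close>

definition abs_continuous_on_interval ::
    "real \<Rightarrow> real \<Rightarrow> (real \<Rightarrow> 'a::real_normed_vector) \<Rightarrow> bool" where
  "abs_continuous_on_interval l r x \<longleftrightarrow>
     (\<forall>\<epsilon>>0. \<exists>\<delta>>0. \<forall>D :: (real \<times> real) set.
        finite D \<longrightarrow>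
        (\<forall>(a, b)\<in>D. l \<le> a \<and> a \<le> b \<and> b \<le> r) \<longrightarrow>
        pairwise (\<lambda>(a, b) (a', b'). {a<..<b} \<inter> {a'<..<b'} = {}) D \<longrightarrow>
        (\<Sum>(a, b)\<in>D. b - a) < \<delta> \<longrightarrow>
        (\<Sum>(a, b)\<in>D. norm (x b - x a)) < \<epsilon>)"

definition dot :: "real \<Rightarrow> (real \<Rightarrow> 'a::real_normed_vector) \<Rightarrow> real \<Rightarrow> 'a" where
  "dot T x t = vector_derivative x (at t within {0..T})"

definition Linf :: "real \<Rightarrow> (real \<Rightarrow> 'a::euclidean_space) \<Rightarrow> bool" where
  "Linf T f \<longleftrightarrow> f \<in> borel_measurable (lebesgue_on {0..T}) \<and>
     (\<exists>C. AE t in lebesgue_on {0..T}. norm (f t) \<le> C)"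

text \<open>
  Differentiability almost everywhere is a consequence of absolute continuity; it is listed only to
  make explicit that \<^const>\<open>dot\<close> is a genuine derivative almost everywhere.
\<close>

definition W1inf :: "real \<Rightarrow> (real \<Rightarrow> 'a::euclidean_space) \<Rightarrow> bool" where
  "W1inf T x \<longleftrightarrow> abs_continuous_on_interval 0 T x \<and>
     (AE t in lebesgue_on {0..T}. x differentiable (at t within {0..T})) \<and>
     Linf T (dot T x)"

definition spaceX :: "real \<Rightarrow> ('n::finite, 'm::finite) traj set" where
  "spaceX T = {z. W1inf T (fst z) \<and> Linf T (snd z)}"

definition L1_norm :: "real \<Rightarrow> (real \<Rightarrow> 'a::euclidean_space) \<Rightarrow> real" where
  "L1_norm T f = (LINT t|lebesgue_on {0..T}. norm (f t))"

definition L2_norm :: "real \<Rightarrow> (real \<Rightarrow> 'a::euclidean_space) \<Rightarrow> real" where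
  "L2_norm T f = sqrt (LINT t|lebesgue_on {0..T}. (norm (f t))\<^sup>2)"

definition traj_L2_norm :: "real \<Rightarrow> ('n::finite, 'm::finite) traj \<Rightarrow> real" where
  "traj_L2_norm T z =
     sqrt (LINT t|lebesgue_on {0..T}. (norm (fst z t))\<^sup>2 + (norm (snd z t))\<^sup>2)"

definition Y_norm :: "real \<Rightarrow> ('n::finite, 'm::finite) traj \<Rightarrow> real" where
  "Y_norm T z = L1_norm T (fst z) + L1_norm T (dot T (fst z)) + L1_norm T (snd z)"

definition traj_convex :: "('n::finite, 'm::finite) traj set \<Rightarrow> bool" where
  "traj_convex A \<longleftrightarrow> (\<forall>z\<in>A. \<forall>w\<in>A. \<forall>s\<in>{0..1}. traj_lin (1 - s) z s w \<in> A)"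

text \<open>In particular such a set is invariant under changing representatives.\<close>

definition Y_closed_in_X :: "real \<Rightarrow> ('n::finite, 'm::finite) traj set \<Rightarrow> bool" where
  "Y_closed_in_X T A \<longleftrightarrow>
     (\<forall>z\<in>spaceX T. (\<forall>\<epsilon>>0. \<exists>w\<in>A. Y_norm T (traj_diff w z) < \<epsilon>) \<longrightarrow> z \<in> A)"


section \<open>Convex analysis\<close>

definition subdiff :: "('a::real_inner \<Rightarrow> real) \<Rightarrow> 'a \<Rightarrow> 'a set" where
  "subdiff f z = {v. \<forall>y. f y \<ge> f z + v \<bullet> (y - z)}"

definition strongly_convex :: "real \<Rightarrow> ('a::real_inner \<Rightarrow> real) \<Rightarrow> bool" where
  "strongly_convex \<mu> f \<longleftrightarrow> convex_on UNIV (\<lambda>z. f z - \<mu> / 2 * (norm z)\<^sup>2)"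

definition eps_optimal :: "('a \<Rightarrow> real) \<Rightarrow> 'a set \<Rightarrow> real \<Rightarrow> 'a \<Rightarrow> bool" where
  "eps_optimal f A \<epsilon> z \<longleftrightarrow> z \<in> A \<and> ereal (f z) \<le> (INF w\<in>A. ereal (f w)) + ereal \<epsilon>"

definition caratheodory :: "real \<Rightarrow> ('a::euclidean_space \<Rightarrow> real \<Rightarrow> real) \<Rightarrow> bool" where
  "caratheodory T f \<longleftrightarrow>
     (AE t in lebesgue_on {0..T}. continuous_on UNIV (\<lambda>z. f z t)) \<and>
     (\<forall>z. (\<lambda>t. f z t) \<in> borel_measurable (lebesgue_on {0..T}))"

definition measurable_multifunction ::
    "real \<Rightarrow> (real \<Rightarrow> 'a::euclidean_space set) \<Rightarrow> bool" where
  "measurable_multifunction T S \<longleftrightarrow>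
     (\<forall>U. open U \<longrightarrow> {t \<in> {0..T}. S t \<inter> U \<noteq> {}} \<in> sets (lebesgue_on {0..T}))"


section \<open>Problem data\<close>

text \<open>
  The indices \<open>1, \<dots>, n\<close> of the components of the dynamics are the elements of \<open>'n\<close>; the index \<open>0\<close>
  of the integrand of the cost gets fields of its own. The fields \<open>g_of\<close>, \<open>h_of\<close> are relevant on
  \<open>{0..lE}\<close>, and \<open>p_of\<close>, \<open>q_of\<close> on \<open>{1..lM}\<close>.
\<close>

record ('n, 'm) dc_problem =
  T_of :: real
  G0_of :: "(real^'n) \<times> (real^'m) \<Rightarrow> real \<Rightarrow> real"
  H0_of :: "(real^'n) \<times> (real^'m) \<Rightarrow> real \<Rightarrow> real"
  G_of :: "'n \<Rightarrow> (real^'n) \<times> (real^'m) \<Rightarrow> real \<Rightarrow> real"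
  H_of :: "'n \<Rightarrow> (real^'n) \<times> (real^'m) \<Rightarrow> real \<Rightarrow> real"
  g_of :: "nat \<Rightarrow> (real^'n) \<times> (real^'n) \<Rightarrow> real"
  h_of :: "nat \<Rightarrow> (real^'n) \<times> (real^'n) \<Rightarrow> real"
  p_of :: "nat \<Rightarrow> (real^'n) \<times> (real^'m) \<Rightarrow> real \<Rightarrow> real"
  q_of :: "nat \<Rightarrow> (real^'n) \<times> (real^'m) \<Rightarrow> real \<Rightarrow> real"
  lI_of :: nat
  lE_of :: nat
  lM_of :: nat
  X0_of :: "((real \<Rightarrow> real^'n) \<times> (real \<Rightarrow> real^'m)) set"

definition idxI :: "('n::finite, 'm::finite) dc_problem \<Rightarrow> nat set" where
  "idxI P = {1..lI_of P}"

definition idxE :: "('n::finite, 'm::finite) dc_problem \<Rightarrow> nat set" where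
  "idxE P = {lI_of P + 1..lE_of P}"

definition idxM :: "('n::finite, 'm::finite) dc_problem \<Rightarrow> nat set" where
  "idxM P = {1..lM_of P}"

definition integrands ::
    "('n::finite, 'm::finite) dc_problem \<Rightarrow> ((real^'n) \<times> (real^'m) \<Rightarrow> real \<Rightarrow> real) set" where
  "integrands P =
     {G0_of P, H0_of P} \<union> range (G_of P) \<union> range (H_of P) \<union> p_of P ` idxM P \<union> q_of P ` idxM P"

definition dc_data_assumptions :: "('n::finite, 'm::finite) dc_problem \<Rightarrow> bool" where
  "dc_data_assumptions P \<longleftrightarrow>
     T_of P > 0 \<and> lI_of P \<le> lE_of P \<and>
     (\<forall>f\<in>integrands P. \<forall>t\<in>{0..T_of P}. convex_on UNIV (\<lambda>z. f z t)) \<and>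
     (\<forall>i\<le>lE_of P. convex_on UNIV (g_of P i) \<and> convex_on UNIV (h_of P i)) \<and>
     (\<forall>f\<in>integrands P. caratheodory (T_of P) f) \<and>
     (\<forall>f\<in>integrands P. \<forall>z\<in>spaceX (T_of P).
        measurable_multifunction (T_of P) (\<lambda>t. subdiff (\<lambda>y. f y t) (traj_at z t))) \<and>
     (\<forall>R>0. \<exists>\<gamma>>0. AE t in lebesgue_on {0..T_of P}. \<forall>x u. norm x + norm u \<le> R \<longrightarrow>
        (\<forall>f\<in>integrands P. \<bar>f (x, u) t\<bar> \<le> \<gamma> \<and>
           (\<forall>v\<in>subdiff (\<lambda>y. f y t) (x, u). norm v \<le> \<gamma>))) \<and>
     X0_of P \<subseteq> spaceX (T_of P) \<and> traj_convex (X0_of P) \<and> Y_closed_in_X (T_of P) (X0_of P)"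


section \<open>Penalty function\<close>

definition f_of :: "('n::finite, 'm::finite) dc_problem \<Rightarrow> nat \<Rightarrow> (real^'n) \<times> (real^'n) \<Rightarrow> real" where
  "f_of P i y = g_of P i y - h_of P i y"

definition costJ :: "('n::finite, 'm::finite) dc_problem \<Rightarrow> ('n, 'm) traj \<Rightarrow> real" where
  "costJ P z =
     (LINT t|lebesgue_on {0..T_of P}. G0_of P (traj_at z t) t - H0_of P (traj_at z t) t)
     + f_of P 0 (traj_ends (T_of P) z)"

definition penalty_phi :: "('n::finite, 'm::finite) dc_problem \<Rightarrow> ('n, 'm) traj \<Rightarrow> real" where
  "penalty_phi P z =
     (\<Sum>i\<in>UNIV. LINT t|lebesgue_on {0..T_of P}.
        \<bar>dot (T_of P) (fst z) t $ i - (G_of P i (traj_at z t) t - H_of P i (traj_at z t) t)\<bar>)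
     + (\<Sum>i\<in>idxI P. max 0 (f_of P i (traj_ends (T_of P) z)))
     + (\<Sum>j\<in>idxE P. \<bar>f_of P j (traj_ends (T_of P) z)\<bar>)
     + (\<Sum>s\<in>idxM P. LINT t|lebesgue_on {0..T_of P}.
          max 0 (p_of P s (traj_at z t) t - q_of P s (traj_at z t) t))"

definition penalty_Phi :: "('n::finite, 'm::finite) dc_problem \<Rightarrow> real \<Rightarrow> ('n, 'm) traj \<Rightarrow> real" where
  "penalty_Phi P c z = costJ P z + c * penalty_phi P z"


section \<open>Convex majorants\<close>

record ('n, 'm) subgrads =
  V0_of :: "real \<Rightarrow> (real^'n) \<times> (real^'m)"
  V_of :: "'n \<Rightarrow> real \<Rightarrow> (real^'n) \<times> (real^'m)"
  W_of :: "'n \<Rightarrow> real \<Rightarrow> (real^'n) \<times> (real^'m)"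
  v_of :: "nat \<Rightarrow> (real^'n) \<times> (real^'n)"
  w_of :: "nat \<Rightarrow> (real^'n) \<times> (real^'n)"
  z_of :: "nat \<Rightarrow> real \<Rightarrow> (real^'n) \<times> (real^'m)"

definition measurable_selection ::
    "real \<Rightarrow> ((real^'n::finite) \<times> (real^'m::finite) \<Rightarrow> real \<Rightarrow> real) \<Rightarrow> ('n, 'm) traj
     \<Rightarrow> (real \<Rightarrow> (real^'n) \<times> (real^'m)) \<Rightarrow> bool" where
  "measurable_selection T f zb V \<longleftrightarrow>
     V \<in> borel_measurable (lebesgue_on {0..T}) \<and>
     (AE t in lebesgue_on {0..T}. V t \<in> subdiff (\<lambda>y. f y t) (traj_at zb t))"

definition subgrad_collection ::
    "('n::finite, 'm::finite) dc_problem \<Rightarrow> ('n, 'm) traj \<Rightarrow> ('n, 'm) subgrads \<Rightarrow> bool" where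
  "subgrad_collection P zb V \<longleftrightarrow>
     measurable_selection (T_of P) (H0_of P) zb (V0_of V) \<and>
     (\<forall>i. measurable_selection (T_of P) (H_of P i) zb (V_of V i)) \<and>
     (\<forall>i. measurable_selection (T_of P) (G_of P i) zb (W_of V i)) \<and>
     (\<forall>s\<in>idxM P. measurable_selection (T_of P) (q_of P s) zb (z_of V s)) \<and>
     (\<forall>i\<le>lE_of P. v_of V i \<in> subdiff (h_of P i) (traj_ends (T_of P) zb)) \<and>
     (\<forall>j\<in>idxE P. w_of V j \<in> subdiff (g_of P j) (traj_ends (T_of P) zb))"

definition Gam ::
    "('n::finite, 'm::finite) dc_problem \<Rightarrow> ('n, 'm) traj \<Rightarrow> ('n, 'm) subgrads
     \<Rightarrow> ('n, 'm) traj \<Rightarrow> real" where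
  "Gam P zb V z =
     (let T = T_of P;
          y = traj_at z; yb = traj_at zb;
          b = traj_ends T z; bb = traj_ends T zb
      in
       (\<Sum>i\<in>UNIV. LINT t|lebesgue_on {0..T}.
          max (dot T (fst z) t $ i + H_of P i (y t) t - G_of P i (yb t) t
                 - W_of V i t \<bullet> (y t - yb t))
              (- (dot T (fst z) t $ i) + G_of P i (y t) t - H_of P i (yb t) t
                 - V_of V i t \<bullet> (y t - yb t)))
       + (\<Sum>i\<in>idxI P. max 0 (g_of P i b - h_of P i bb - v_of V i \<bullet> (b - bb)))
       + (\<Sum>j\<in>idxE P. max (g_of P j b - h_of P j bb - v_of V j \<bullet> (b - bb))
                            (h_of P j b - g_of P j bb - w_of V j \<bullet> (b - bb)))
       + (\<Sum>s\<in>idxM P. LINT t|lebesgue_on {0..T}.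
            max 0 (p_of P s (y t) t - q_of P s (yb t) t - z_of V s t \<bullet> (y t - yb t))))"

definition omg ::
    "('n::finite, 'm::finite) dc_problem \<Rightarrow> ('n, 'm) subgrads \<Rightarrow> ('n, 'm) traj \<Rightarrow> real" where
  "omg P V z =
     (LINT t|lebesgue_on {0..T_of P}. G0_of P (traj_at z t) t - V0_of V t \<bullet> traj_at z t)
     + g_of P 0 (traj_ends (T_of P) z) - v_of V 0 \<bullet> traj_ends (T_of P) z"

definition majQ ::
    "('n::finite, 'm::finite) dc_problem \<Rightarrow> real \<Rightarrow> ('n, 'm) traj \<Rightarrow> ('n, 'm) subgrads
     \<Rightarrow> ('n, 'm) traj \<Rightarrow> real" where
  "majQ P c zb V z = omg P V z + c * Gam P zb V z"


section \<open>The method B-STEP-DCA\<close>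

record bstep_params =
  eta1 :: real
  eta2 :: real
  zeta :: real
  sigma :: real
  eps_phi :: real
  eps_feas :: real

definition valid_params :: "bstep_params \<Rightarrow> bool" where
  "valid_params B \<longleftrightarrow>
     eta1 B \<in> {0<..<1} \<and> eta2 B \<in> {0<..<1} \<and> zeta B \<in> {0<..<1} \<and> sigma B \<in> {0<..<1} \<and>
     eps_phi B > 0 \<and> eps_feas B > 0"

text \<open>
  \<open>raise_loop \<kappa> computed ok c c'\<close>: the loop ``while \<open>ok\<close> fails, increase the penalty parameter and
  recompute'', started with the parameter \<open>c\<close>, terminates with the parameter \<open>c'\<close>. Every increase is
  by at least \<open>\<kappa>\<close>, and \<open>computed\<close> has to hold for each new value of the parameter.
\<close>

inductive raise_loop :: "real \<Rightarrow> (real \<Rightarrow> bool) \<Rightarrow> (real \<Rightarrow> bool) \<Rightarrow> real \<Rightarrow> real \<Rightarrow> bool"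
  for \<kappa> :: real and computed ok :: "real \<Rightarrow> bool" where
  stop: "ok c \<Longrightarrow> raise_loop \<kappa> computed ok c c"
| raise: "\<not> ok c \<Longrightarrow> c' \<ge> c + \<kappa> \<Longrightarrow> computed c' \<Longrightarrow> raise_loop \<kappa> computed ok c' c''
    \<Longrightarrow> raise_loop \<kappa> computed ok c c''"

text \<open>
  In the next three definitions \<open>zk\<close> is the current iterate, \<open>V\<close> the chosen collection of subgradients
  at \<open>zk\<close>, and \<open>S c\<close> the point computed for the penalty parameter \<open>c\<close>. Within one iteration the
  parameter strictly increases, so each of its values is used for at most one computation; \<open>S\<close> is
  constrained only at the values actually used. Besides \<open>\<epsilon>\<close>-optimality a computed point
  satisfies the standing requirement not to be worse than the current iterate.
\<close>

definition computed_point ::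
    "('n::finite, 'm::finite) dc_problem \<Rightarrow> real \<Rightarrow> ('n, 'm) traj \<Rightarrow> ('n, 'm) subgrads
     \<Rightarrow> (real \<Rightarrow> ('n, 'm) traj) \<Rightarrow> real \<Rightarrow> bool" where
  "computed_point P \<epsilon> zk V S c \<longleftrightarrow>
     eps_optimal (majQ P c zk V) (X0_of P) \<epsilon> (S c) \<and>
     majQ P c zk V (S c) \<le> majQ P c zk V zk"

text \<open>Steps 1--4, leading from the penalty parameter \<open>ck\<close> to \<open>cn\<close>.\<close>

definition penalty_steps ::
    "('n::finite, 'm::finite) dc_problem \<Rightarrow> bstep_params \<Rightarrow> real \<Rightarrow> real
     \<Rightarrow> ('n, 'm) traj \<Rightarrow> ('n, 'm) subgrads \<Rightarrow> (real \<Rightarrow> ('n, 'm) traj) \<Rightarrow> real \<Rightarrow> real \<Rightarrow> bool" where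
  "penalty_steps P B \<kappa> \<epsilon> zk V S ck cn \<longleftrightarrow>
     (let \<Gamma> = Gam P zk V; Q = (\<lambda>c. majQ P c zk V);
          computed = computed_point P \<epsilon> zk V S
      in
       computed ck \<and>
       (\<exists>cp.
          (if \<Gamma> (S ck) \<le> eps_phi B then cp = ck
           else (\<exists>zhat. eps_optimal \<Gamma> (X0_of P) \<epsilon> zhat \<and>
             (if \<Gamma> zhat < \<Gamma> zk
              then raise_loop \<kappa> computed
                     (\<lambda>c. \<Gamma> (S c) - \<Gamma> zk \<le> eta1 B * (\<Gamma> zhat - \<Gamma> zk)) ck cp
              else raise_loop \<kappa> computed
                     (\<lambda>c. \<Gamma> (S c) \<le> \<Gamma> zk + eps_feas B) ck cp))) \<and>
          raise_loop \<kappa> computed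
            (\<lambda>c. Q c (S c) - Q c zk \<le> c * eta2 B * (\<Gamma> (S c) - \<Gamma> zk)) cp cn))"

text \<open>Step 5, leading from \<open>zk\<close> and \<open>zc = S cn\<close> to the next iterate \<open>zn\<close>.\<close>

definition line_search_step ::
    "('n::finite, 'm::finite) dc_problem \<Rightarrow> bstep_params \<Rightarrow> real \<Rightarrow> real \<Rightarrow> real
     \<Rightarrow> ('n, 'm) traj \<Rightarrow> ('n, 'm) traj \<Rightarrow> ('n, 'm) traj \<Rightarrow> bool" where
  "line_search_step P B \<nu> \<alpha>bar cn zk zc zn \<longleftrightarrow>
     (let d = traj_diff zc zk;
          \<alpha> = (\<lambda>j. zeta B ^ j * \<alpha>bar);
          trial = (\<lambda>j. traj_lin 1 zc (\<alpha> j) d);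
          accept = (\<lambda>j::nat. penalty_Phi P cn (trial j) - penalty_Phi P cn zc
                      \<le> - sigma B * (\<alpha> j)\<^sup>2 * (traj_L2_norm (T_of P) d)\<^sup>2 + \<nu>)
      in
       \<nu> > 0 \<and> \<alpha>bar \<ge> 0 \<and> (\<forall>j. trial j \<in> X0_of P) \<and>
       (\<exists>j. accept j \<and> (\<forall>i<j. \<not> accept i) \<and> zn = trial j))"

text \<open>
  An infinite run of the method with iterates \<open>z k\<close> and penalty parameters \<open>c k\<close>, together with the
  standing assumptions on the method.
\<close>

definition bstep_dca_run ::
    "('n::finite, 'm::finite) dc_problem \<Rightarrow> bstep_params \<Rightarrow> real \<Rightarrow> (nat \<Rightarrow> real) \<Rightarrow> (nat \<Rightarrow> real)
     \<Rightarrow> (nat \<Rightarrow> real) \<Rightarrow> (nat \<Rightarrow> ('n, 'm) subgrads) \<Rightarrow> (nat \<Rightarrow> real \<Rightarrow> ('n, 'm) traj)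
     \<Rightarrow> (nat \<Rightarrow> ('n, 'm) traj) \<Rightarrow> (nat \<Rightarrow> real) \<Rightarrow> bool" where
  "bstep_dca_run P B \<kappa> \<epsilon> \<nu> \<alpha>bar V S z c \<longleftrightarrow>
     valid_params B \<and> \<kappa> > 0 \<and> (\<forall>k. \<epsilon> k > 0) \<and>
     z 0 \<in> X0_of P \<and> c 0 > 0 \<and> bdd_below (penalty_Phi P (c 0) ` X0_of P) \<and>
     (\<forall>k. subgrad_collection P (z k) (V k) \<and>
          penalty_steps P B \<kappa> (\<epsilon> k) (z k) (V k) (S k) (c k) (c (Suc k)) \<and>
          line_search_step P B (\<nu> k) (\<alpha>bar k) (c (Suc k)) (z k) (S k (c (Suc k))) (z (Suc k)))"

end

theory Submission
  imports Defs
begin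

text \<open>
  The convexified problem majorizes the penalty function up to a constant, and this majorization is
  exact at the current iterate. Strong convexity of the subtracted function \<open>H\<^sub>0\<close>, whose
  linearization enters the majorant, makes the gap at least \<open>\<mu>/2\<close> times the squared \<open>L\<^sup>2\<close> distance.
  Hence passing from \<open>z\<^sub>k\<close> to the computed point decreases the penalty function by this amount, and
  the line search decreases it by a further multiple of the squared length of its step, up to
  \<open>\<nu>\<^sub>k\<close>. A bounded sequence of penalty parameters that grows in jumps of size at least \<open>\<kappa>\<close> is
  eventually constant, so from some index on all decrements concern one and the same function,
  which is bounded below; their sum is finite.
\<close>

section \<open>Essentially bounded functions\<close>

lemma Linf_imp_integrable:
  assumes "Linf T f"
  shows "integrable (lebesgue_on {0..T}) f"
proof -
  interpret finite_measure "lebesgue_on {0..T}"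
    by (rule finite_measure_lebesgue_on) simp
  from assms show ?thesis
    unfolding Linf_def by (auto intro: integrable_const_bound)
qed

lemma Linf_const: "Linf T (\<lambda>t. k)"
  by (auto simp: Linf_def)

text \<open>The arguments stay almost everywhere in a product of closed balls. That product is
  compact, so its continuous image is bounded. All closure rules below are instances, and through
  them every integrability goal is settled.\<close>

lemma Linf_continuous2:
  fixes f :: "real \<Rightarrow> 'a::euclidean_space" and g :: "real \<Rightarrow> 'b::euclidean_space"
    and h :: "'a \<Rightarrow> 'b \<Rightarrow> 'c::euclidean_space"
  assumes "Linf T f" "Linf T g"
    and cont: "continuous_on UNIV (\<lambda>p. h (fst p) (snd p))"
  shows "Linf T (\<lambda>t. h (f t) (g t))"
proof -
  from assms obtain C D where
    m: "f \<in> borel_measurable (lebesgue_on {0..T})" "g \<in> borel_measurable (lebesgue_on {0..T})" and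
    C: "AE t in lebesgue_on {0..T}. norm (f t) \<le> C" and
    D: "AE t in lebesgue_on {0..T}. norm (g t) \<le> D"
    unfolding Linf_def by auto
  have "compact ((\<lambda>p. h (fst p) (snd p)) ` (cball 0 C \<times> cball 0 D))"
    by (intro compact_continuous_image continuous_on_subset[OF cont] compact_Times) auto
  then obtain E where E: "\<And>p. p \<in> cball 0 C \<times> cball 0 D \<Longrightarrow> norm (h (fst p) (snd p)) \<le> E"
    by (meson compact_imp_bounded bounded_iff imageI)
  have "AE t in lebesgue_on {0..T}. norm (h (f t) (g t)) \<le> E"
    using C D by eventually_elim (use E in force)
  moreover have "(\<lambda>t. h (f t) (g t)) \<in> borel_measurable (lebesgue_on {0..T})"
    using borel_measurable_continuous_Pair[OF m, of h] cont by (simp add: case_prod_beta)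
  ultimately show ?thesis unfolding Linf_def by blast
qed

lemma Linf_add: "Linf T f \<Longrightarrow> Linf T g \<Longrightarrow> Linf T (\<lambda>t. f t + g t)"
  by (rule Linf_continuous2) (auto intro!: continuous_intros)

lemma Linf_diff: "Linf T f \<Longrightarrow> Linf T g \<Longrightarrow> Linf T (\<lambda>t. f t - g t)"
  by (rule Linf_continuous2) (auto intro!: continuous_intros)

lemma Linf_inner: "Linf T f \<Longrightarrow> Linf T g \<Longrightarrow> Linf T (\<lambda>t. f t \<bullet> g t)"
  by (rule Linf_continuous2) (auto intro!: continuous_intros)

lemma Linf_Pair: "Linf T f \<Longrightarrow> Linf T g \<Longrightarrow> Linf T (\<lambda>t. (f t, g t))"
  by (rule Linf_continuous2) (auto intro!: continuous_intros)

lemma Linf_max: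
  fixes f g :: "real \<Rightarrow> real"
  shows "Linf T f \<Longrightarrow> Linf T g \<Longrightarrow> Linf T (\<lambda>t. max (f t) (g t))"
  by (rule Linf_continuous2) (auto intro!: continuous_intros)

text \<open>A unary operation is treated as a binary one that ignores its second argument.\<close>

lemma Linf_uminus: "Linf T f \<Longrightarrow> Linf T (\<lambda>t. - f t)"
  by (rule Linf_continuous2[where h = "\<lambda>a b. - a"]) (auto intro!: continuous_intros)

lemma Linf_abs:
  fixes f :: "real \<Rightarrow> real"
  shows "Linf T f \<Longrightarrow> Linf T (\<lambda>t. \<bar>f t\<bar>)"
  by (rule Linf_continuous2[where h = "\<lambda>a b. \<bar>a\<bar>"]) (auto intro!: continuous_intros)

lemma Linf_nth:
  fixes f :: "real \<Rightarrow> real^'n::finite"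
  shows "Linf T f \<Longrightarrow> Linf T (\<lambda>t. f t $ i)"
  by (rule Linf_continuous2[where h = "\<lambda>a b. a $ i"]) (auto intro!: continuous_intros)

lemma Linf_norm_power2: "Linf T f \<Longrightarrow> Linf T (\<lambda>t. (norm (f t))\<^sup>2)"
  by (rule Linf_continuous2[where h = "\<lambda>a b. (norm a)\<^sup>2"]) (auto intro!: continuous_intros)

lemmas Linf_intros = Linf_const Linf_add Linf_diff Linf_inner Linf_max Linf_uminus Linf_abs
  Linf_nth Linf_norm_power2

lemma abs_continuous_on_interval_imp_continuous_on:
  assumes "abs_continuous_on_interval l r x"
  shows "continuous_on {l..r} x"
  unfolding continuous_on_iff
proof (intro ballI allI impI)
  fix t and e :: real assume t: "t \<in> {l..r}" and "e > 0"
  with assms obtain \<delta> where "\<delta> > 0" and \<delta>: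
    "\<forall>D. finite D \<longrightarrow> (\<forall>(a, b)\<in>D. l \<le> a \<and> a \<le> b \<and> b \<le> r) \<longrightarrow>
        pairwise (\<lambda>(a, b) (a', b'). {a<..<b} \<inter> {a'<..<b'} = {}) D \<longrightarrow>
        (\<Sum>(a, b)\<in>D. b - a) < \<delta> \<longrightarrow> (\<Sum>(a, b)\<in>D. norm (x b - x a)) < e"
    unfolding abs_continuous_on_interval_def by blast
  \<comment> \<open>A family consisting of one interval suffices; \<open>min\<close> and
    \<open>max\<close> order its endpoints.\<close>
  have "dist (x s) (x t) < e" if "s \<in> {l..r}" "dist s t < \<delta>" for s
    using \<delta>[rule_format, of "{(min s t, max s t)}"] that t
    by (cases "s \<le> t") (auto simp: dist_real_def dist_norm norm_minus_commute)
  with \<open>\<delta> > 0\<close> show "\<exists>d>0. \<forall>s\<in>{l..r}. dist s t < d \<longrightarrow> dist (x s) (x t) < e"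
    by blast
qed

lemma continuous_on_imp_Linf:
  assumes "continuous_on {0..T} f"
  shows "Linf T f"
proof -
  have "bounded (f ` {0..T})"
    using assms by (intro compact_imp_bounded compact_continuous_image) auto
  then obtain C where "\<And>t. t \<in> {0..T} \<Longrightarrow> norm (f t) \<le> C"
    by (meson bounded_iff imageI)
  then have "AE t in lebesgue_on {0..T}. norm (f t) \<le> C"
    by (intro AE_I2) simp
  moreover have "f \<in> borel_measurable (lebesgue_on {0..T})"
    using assms by (rule continuous_imp_measurable_on_sets_lebesgue) simp
  ultimately show ?thesis unfolding Linf_def by blast
qed

lemma Linf_traj_at:
  assumes "z \<in> spaceX T"
  shows "Linf T (traj_at z)"
proof -
  have "Linf T (fst z)"
    using assms unfolding spaceX_def W1inf_def
    by (auto intro: continuous_on_imp_Linf abs_continuous_on_interval_imp_continuous_on)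
  moreover have "Linf T (snd z)"
    using assms unfolding spaceX_def by simp
  ultimately have "Linf T (\<lambda>t. (fst z t, snd z t))"
    by (rule Linf_Pair)
  then show ?thesis by (simp add: traj_at_def[abs_def])
qed

lemma Linf_dot_fst: "z \<in> spaceX T \<Longrightarrow> Linf T (dot T (fst z))"
  by (simp add: spaceX_def W1inf_def)

text \<open>Simple functions \<open>s i\<close> approximate \<open>y\<close> pointwise. Each
  \<open>s i\<close> has finitely many values, so inserting it into \<open>f\<close> only glues
  together measurable sections, and continuity of \<open>f\<close> in its first argument carries
  measurability to the limit.\<close>

lemma borel_measurable_superposition:
  fixes f :: "'a::{metric_space, second_countable_topology} \<Rightarrow> 'b \<Rightarrow> 'c::metric_space"
  assumes cont: "\<And>t. t \<in> space M \<Longrightarrow> continuous_on UNIV (\<lambda>z. f z t)"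
    and meas: "\<And>z. f z \<in> borel_measurable M"
    and y: "y \<in> borel_measurable M"
  shows "(\<lambda>t. f (y t) t) \<in> borel_measurable M"
proof -
  from borel_measurable_implies_sequence_metric[OF y]
  obtain s where s: "\<And>i. simple_function M (s i)"
    and lim: "\<And>t. t \<in> space M \<Longrightarrow> (\<lambda>i. s i t) \<longlonglongrightarrow> y t"
    by metis
  show ?thesis
  proof (rule borel_measurable_LIMSEQ_metric)
    fix i
    show "(\<lambda>t. f (s i t) t) \<in> borel_measurable M"
    proof (rule measurable_compose_countable'[where I = "s i ` space M"])
      show "countable (s i ` space M)"
        using s[of i] by (simp add: simple_function_def countable_finite)
      show "s i \<in> measurable M (count_space (s i ` space M))"
        using s[of i]
        by (auto simp: simple_function_def intro!: measurable_count_space_eq2[THEN iffD2])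
    qed (use meas in auto)
  next
    fix t assume "t \<in> space M"
    then show "(\<lambda>i. f (s i t) t) \<longlonglongrightarrow> f (y t) t"
      using continuous_on_tendsto_compose[OF cont lim] by simp
  qed
qed

section \<open>Integrands and their subgradients\<close>

text \<open>An essentially bounded trajectory stays almost everywhere in one ball, on which the data
  assumptions bound both the values and all subgradients by a single constant.\<close>

lemma Linf_integrand:
  assumes P: "dc_data_assumptions P" and f: "f \<in> integrands P" and z: "z \<in> spaceX (T_of P)"
  shows "Linf (T_of P) (\<lambda>t. f (traj_at z t) t)"
    and "measurable_selection (T_of P) f z v \<Longrightarrow> Linf (T_of P) v"
proof -
  let ?M = "lebesgue_on {0..T_of P}"
  from Linf_traj_at[OF z] obtain C where y: "traj_at z \<in> borel_measurable ?M"
    and C: "AE t in ?M. norm (traj_at z t) \<le> C"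
    unfolding Linf_def by blast
  \<comment> \<open>Each component is bounded by the norm of the pair, hence the factor 2; the
    absolute value and the summand 1 ensure that \<open>R\<close> is positive.\<close>
  define R where "R = 2 * \<bar>C\<bar> + 1"
  have "R > 0" by (simp add: R_def)
  moreover have "\<forall>R>0. \<exists>\<gamma>>0. AE t in ?M. \<forall>x u. norm x + norm u \<le> R \<longrightarrow>
        (\<forall>f\<in>integrands P. \<bar>f (x, u) t\<bar> \<le> \<gamma> \<and>
           (\<forall>v\<in>subdiff (\<lambda>y. f y t) (x, u). norm v \<le> \<gamma>))"
    using P unfolding dc_data_assumptions_def by (elim conjE) assumption
  ultimately obtain \<gamma> where \<gamma>: "AE t in ?M. \<forall>x u. norm x + norm u \<le> R \<longrightarrow>
        (\<forall>f\<in>integrands P. \<bar>f (x, u) t\<bar> \<le> \<gamma> \<and>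
           (\<forall>v\<in>subdiff (\<lambda>y. f y t) (x, u). norm v \<le> \<gamma>))"
    by (elim allE[of _ R] impE) auto
  have bound: "AE t in ?M. \<bar>f (traj_at z t) t\<bar> \<le> \<gamma> \<and>
      (\<forall>v\<in>subdiff (\<lambda>y. f y t) (traj_at z t). norm v \<le> \<gamma>)"
    using C \<gamma>
  proof eventually_elim
    case (elim t)
    then have "norm (fst z t) + norm (snd z t) \<le> R"
      using norm_fst_le[of "fst z t" "snd z t"] norm_snd_le[of "snd z t" "fst z t"]
      by (simp add: R_def traj_at_def)
    with elim(2) f show ?case by (simp add: traj_at_def)
  qed
  have "(\<lambda>t. f (traj_at z t) t) \<in> borel_measurable ?M"
  proof (rule borel_measurable_superposition[OF _ _ y])
    fix t assume "t \<in> space ?M"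
    \<comment> \<open>A finite convex function on a finite-dimensional space is continuous. This
      holds for every \<open>t\<close> in the interval, as the superposition lemma demands.\<close>
    with P f show "continuous_on UNIV (\<lambda>z. f z t)"
      unfolding dc_data_assumptions_def by (intro convex_on_continuous) auto
  next
    fix z
    have "caratheodory (T_of P) f"
      using P f unfolding dc_data_assumptions_def by blast
    then show "f z \<in> borel_measurable ?M"
      unfolding caratheodory_def by blast
  qed
  moreover have "AE t in ?M. norm (f (traj_at z t) t) \<le> \<gamma>"
    using bound by eventually_elim simp
  ultimately show "Linf (T_of P) (\<lambda>t. f (traj_at z t) t)"
    unfolding Linf_def by blast
  assume "measurable_selection (T_of P) f z v"
  then have v: "v \<in> borel_measurable ?M"
    and sel: "AE t in ?M. v t \<in> subdiff (\<lambda>y. f y t) (traj_at z t)"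
    by (auto simp: measurable_selection_def)
  from sel bound have "AE t in ?M. norm (v t) \<le> \<gamma>"
    by eventually_elim blast
  with v show "Linf (T_of P) v" unfolding Linf_def by blast
qed

lemma integrands_memI:
  "G0_of P \<in> integrands P" "H0_of P \<in> integrands P" "G_of P i \<in> integrands P"
  "H_of P i \<in> integrands P"
  "s \<in> idxM P \<Longrightarrow> p_of P s \<in> integrands P" "s \<in> idxM P \<Longrightarrow> q_of P s \<in> integrands P"
  by (auto simp: integrands_def)

lemma subdiff_ge: "v \<in> subdiff f z \<Longrightarrow> f z + v \<bullet> (y - z) \<le> f y"
  by (simp add: subdiff_def)

text \<open>The exceptional null set does not depend on \<open>y\<close>, so at each remaining
  \<open>t\<close> the inequality may be used with a \<open>y\<close> that varies with
  \<open>t\<close>, such as the value of another trajectory.\<close>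

lemma measurable_selection_ge:
  assumes "measurable_selection T f zb v"
  shows "AE t in lebesgue_on {0..T}.
    \<forall>y. f (traj_at zb t) t + v t \<bullet> (y - traj_at zb t) \<le> f y t"
  using assms by (auto simp: measurable_selection_def subdiff_def)

text \<open>On the segment from \<open>z\<close> to \<open>y\<close>, strong convexity bounds
  \<open>f\<close> from above and the subgradient bounds it from below. Comparing the two at
  parameter \<open>s\<close>, dividing by \<open>s\<close> and letting \<open>s\<close> tend to 0
  yields the quadratic gap without any smoothness.\<close>

lemma strongly_convex_subdiff_ge:
  fixes f :: "'a::real_inner \<Rightarrow> real"
  assumes sc: "strongly_convex \<mu> f" and v: "v \<in> subdiff f z"
  shows "f z + v \<bullet> (y - z) + \<mu> / 2 * (norm (y - z))\<^sup>2 \<le> f y"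
proof -
  let ?N = "\<mu> / 2 * (norm (y - z))\<^sup>2"
  have *: "v \<bullet> (y - z) + (1 - s) * ?N \<le> f y - f z" if s: "0 < s" "s < 1" for s
  proof -
    let ?w = "(1 - s) *\<^sub>R z + s *\<^sub>R y"
    have "f ?w - \<mu> / 2 * (norm ?w)\<^sup>2
        \<le> (1 - s) * (f z - \<mu> / 2 * (norm z)\<^sup>2) + s * (f y - \<mu> / 2 * (norm y)\<^sup>2)"
      using convex_onD[OF sc[unfolded strongly_convex_def], of s z y] s by simp
    \<comment> \<open>The squared norm has the exact convexity defect
      \<open>s * (1 - s) * (norm (y - z))\<^sup>2\<close>; this is what strong convexity gains over
      plain convexity.\<close>
    moreover have "(norm ?w)\<^sup>2
        = (1 - s) * (norm z)\<^sup>2 + s * (norm y)\<^sup>2 - s * (1 - s) * (norm (y - z))\<^sup>2"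
      unfolding power2_norm_eq_inner
      by (simp add: inner_add_left inner_add_right inner_diff_left inner_diff_right inner_commute
          algebra_simps)
    ultimately have "f ?w \<le> (1 - s) * f z + s * f y - s * (1 - s) * ?N"
      by (simp only:) (simp add: field_simps)
    moreover have "f z + s * (v \<bullet> (y - z)) \<le> f ?w"
    proof -
      have "?w - z = s *\<^sub>R (y - z)" by (simp add: algebra_simps)
      then show ?thesis using subdiff_ge[OF v, of ?w] by simp
    qed
    ultimately have "s * (v \<bullet> (y - z) + (1 - s) * ?N) \<le> s * (f y - f z)"
      by (simp add: algebra_simps)
    then show ?thesis using s by simp
  qed
  \<comment> \<open>In the limit the factor \<open>1 - s\<close> becomes 1, so the full modulus
    survives.\<close>
  have "((\<lambda>s. v \<bullet> (y - z) + (1 - s) * ?N) \<longlongrightarrow> v \<bullet> (y - z) + (1 - 0) * ?N) (at_right 0)"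
    by (intro tendsto_intros)
  moreover have "eventually (\<lambda>s. v \<bullet> (y - z) + (1 - s) * ?N \<le> f y - f z) (at_right (0::real))"
    unfolding eventually_at_right_field using * by (auto intro!: exI[of _ 1])
  ultimately have "v \<bullet> (y - z) + (1 - 0) * ?N \<le> f y - f z"
    by (rule tendsto_upperbound) simp
  then show ?thesis by simp
qed

section \<open>Majorization of the penalty function\<close>

text \<open>At the base point the linear terms vanish, and the maximum of a number and its negative
  is its absolute value. Hence the majorant touches the penalty term there.\<close>

lemma Gam_self: "Gam P zb V zb = penalty_phi P zb"
proof -
  have "max (a + h - g) (g - a - h) = \<bar>a - (g - h)\<bar>" for a g h :: real
    by (simp add: max_def abs_if)
  moreover have "max (g - h) (h - g) = \<bar>g - h\<bar>" for g h :: real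
    by (simp add: max_def abs_if)
  ultimately show ?thesis
    by (simp add: Gam_def penalty_phi_def Let_def f_of_def)
qed

text \<open>An absolute value is the maximum of a difference of convex functions and its negative.
  In each branch the subtracted convex function is replaced by its affine minorant at
  \<open>zb\<close>, which can only enlarge the branch; the comparison is then made term by
  term.\<close>

lemma penalty_phi_le_Gam:
  assumes P: "dc_data_assumptions P" and V: "subgrad_collection P zb V"
    and zb: "zb \<in> spaceX (T_of P)" and z: "z \<in> spaceX (T_of P)"
  shows "penalty_phi P z \<le> Gam P zb V z"
proof -
  have lI: "lI_of P \<le> lE_of P" using P by (simp add: dc_data_assumptions_def)
  note data = Linf_integrand(1)[OF P _ z] Linf_integrand(1)[OF P _ zb]
    Linf_traj_at[OF z] Linf_traj_at[OF zb] Linf_dot_fst[OF z] integrands_memI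
  have selV: "measurable_selection (T_of P) (H_of P i) zb (V_of V i)"
    and selW: "measurable_selection (T_of P) (G_of P i) zb (W_of V i)" for i
    using V by (auto simp: subgrad_collection_def)
  have selz: "measurable_selection (T_of P) (q_of P s) zb (z_of V s)" if "s \<in> idxM P" for s
    using V that by (auto simp: subgrad_collection_def)
  have LV: "Linf (T_of P) (V_of V i)" and LW: "Linf (T_of P) (W_of V i)" for i
    by (rule Linf_integrand(2)[OF P _ zb selV] Linf_integrand(2)[OF P _ zb selW],
        rule integrands_memI)+
  have Lz: "Linf (T_of P) (z_of V s)" if "s \<in> idxM P" for s
    by (rule Linf_integrand(2)[OF P integrands_memI(6)[OF that] zb selz[OF that]])
  show ?thesis
    unfolding penalty_phi_def Gam_def Let_def
  proof (intro add_mono sum_mono)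
    fix i :: 'a
    show "(LINT t|lebesgue_on {0..T_of P}.
        \<bar>dot (T_of P) (fst z) t $ i - (G_of P i (traj_at z t) t - H_of P i (traj_at z t) t)\<bar>)
      \<le> (LINT t|lebesgue_on {0..T_of P}.
          max (dot (T_of P) (fst z) t $ i + H_of P i (traj_at z t) t - G_of P i (traj_at zb t) t
                 - W_of V i t \<bullet> (traj_at z t - traj_at zb t))
              (- (dot (T_of P) (fst z) t $ i) + G_of P i (traj_at z t) t
                 - H_of P i (traj_at zb t) t - V_of V i t \<bullet> (traj_at z t - traj_at zb t)))"
    proof (rule integral_mono_AE)
      show "AE t in lebesgue_on {0..T_of P}.
        \<bar>dot (T_of P) (fst z) t $ i - (G_of P i (traj_at z t) t - H_of P i (traj_at z t) t)\<bar>
        \<le> max (dot (T_of P) (fst z) t $ i + H_of P i (traj_at z t) t - G_of P i (traj_at zb t) t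
                 - W_of V i t \<bullet> (traj_at z t - traj_at zb t))
              (- (dot (T_of P) (fst z) t $ i) + G_of P i (traj_at z t) t
                 - H_of P i (traj_at zb t) t - V_of V i t \<bullet> (traj_at z t - traj_at zb t))"
        using measurable_selection_ge[OF selV[of i]] measurable_selection_ge[OF selW[of i]]
      proof eventually_elim
        case (elim t)
        from elim[THEN spec[of _ "traj_at z t"]] show ?case
          by (simp add: max_def abs_if)
      qed
    qed (intro Linf_imp_integrable Linf_intros data LV LW)+
  next
    fix i assume "i \<in> idxI P"
    \<comment> \<open>The subgradients \<open>v_of V i\<close> are supplied for
      \<open>i \<le> lE_of P\<close>, and \<open>lI\<close> places the inequality indices in that
      range.\<close>
    then have "v_of V i \<in> subdiff (h_of P i) (traj_ends (T_of P) zb)"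
      using V lI by (auto simp: subgrad_collection_def idxI_def)
    from subdiff_ge[OF this, of "traj_ends (T_of P) z"]
    show "max 0 (f_of P i (traj_ends (T_of P) z))
      \<le> max 0 (g_of P i (traj_ends (T_of P) z) - h_of P i (traj_ends (T_of P) zb)
          - v_of V i \<bullet> (traj_ends (T_of P) z - traj_ends (T_of P) zb))"
      by (simp add: f_of_def max_def)
  next
    fix j assume j: "j \<in> idxE P"
    then have "v_of V j \<in> subdiff (h_of P j) (traj_ends (T_of P) zb)"
      "w_of V j \<in> subdiff (g_of P j) (traj_ends (T_of P) zb)"
      using V by (auto simp: subgrad_collection_def idxE_def)
    from this[THEN subdiff_ge, of "traj_ends (T_of P) z"]
    show "\<bar>f_of P j (traj_ends (T_of P) z)\<bar>
      \<le> max (g_of P j (traj_ends (T_of P) z) - h_of P j (traj_ends (T_of P) zb)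
               - v_of V j \<bullet> (traj_ends (T_of P) z - traj_ends (T_of P) zb))
            (h_of P j (traj_ends (T_of P) z) - g_of P j (traj_ends (T_of P) zb)
               - w_of V j \<bullet> (traj_ends (T_of P) z - traj_ends (T_of P) zb))"
      by (simp add: f_of_def max_def abs_if)
  next
    fix s assume s: "s \<in> idxM P"
    show "(LINT t|lebesgue_on {0..T_of P}.
          max 0 (p_of P s (traj_at z t) t - q_of P s (traj_at z t) t))
      \<le> (LINT t|lebesgue_on {0..T_of P}.
          max 0 (p_of P s (traj_at z t) t - q_of P s (traj_at zb t) t
            - z_of V s t \<bullet> (traj_at z t - traj_at zb t)))"
    proof (rule integral_mono_AE)
      show "AE t in lebesgue_on {0..T_of P}.
          max 0 (p_of P s (traj_at z t) t - q_of P s (traj_at z t) t)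
          \<le> max 0 (p_of P s (traj_at z t) t - q_of P s (traj_at zb t) t
            - z_of V s t \<bullet> (traj_at z t - traj_at zb t))"
        using measurable_selection_ge[OF selz[OF s]]
      proof eventually_elim
        case (elim t)
        from elim[THEN spec[of _ "traj_at z t"]] show ?case
          by (simp add: max_def)
      qed
    qed (intro Linf_imp_integrable Linf_intros data Lz s)+
  qed
qed

lemma penalty_phi_nonneg: "0 \<le> penalty_phi P z"
  unfolding penalty_phi_def by (intro add_nonneg_nonneg sum_nonneg integral_nonneg) auto

text \<open>State and control are merged into one Euclidean norm on the product, the form in which
  strong convexity delivers its gap pointwise.\<close>

lemma traj_L2_norm_power2:
  "(traj_L2_norm T (traj_diff z w))\<^sup>2
     = (LINT t|lebesgue_on {0..T}. (norm (traj_at z t - traj_at w t))\<^sup>2)"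
proof -
  have "(traj_L2_norm T (traj_diff z w))\<^sup>2
      = (LINT t|lebesgue_on {0..T}. (norm (fst z t - fst w t))\<^sup>2 + (norm (snd z t - snd w t))\<^sup>2)"
    unfolding traj_L2_norm_def by (subst real_sqrt_pow2) (auto intro: integral_nonneg)
  then show ?thesis by (simp add: traj_at_def norm_Pair)
qed

text \<open>Passing from the cost to \<open>omg\<close> linearizes \<open>H\<^sub>0\<close> and
  \<open>h\<^sub>0\<close> at \<open>zb\<close>. The constants dropped in \<open>omg\<close> cancel
  in differences, the linearization of \<open>H\<^sub>0\<close> contributes the quadratic gap, and
  that of \<open>h\<^sub>0\<close> only needs convexity.\<close>

lemma costJ_le_omg:
  assumes P: "dc_data_assumptions P" and V: "subgrad_collection P zb V"
    and zb: "zb \<in> spaceX (T_of P)" and z: "z \<in> spaceX (T_of P)"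
    and sc: "AE t in lebesgue_on {0..T_of P}. strongly_convex \<mu> (\<lambda>y. H0_of P y t)"
  shows "costJ P z - costJ P zb + \<mu> / 2 * (traj_L2_norm (T_of P) (traj_diff z zb))\<^sup>2
    \<le> omg P V z - omg P V zb"
proof -
  let ?M = "lebesgue_on {0..T_of P}"
  let ?y = "traj_at z" and ?yb = "traj_at zb" and ?G = "G0_of P" and ?H = "H0_of P"
  let ?b = "traj_ends (T_of P) z" and ?bb = "traj_ends (T_of P) zb"
  have sel: "measurable_selection (T_of P) ?H zb (V0_of V)"
    using V by (simp add: subgrad_collection_def)
  note Linfs = Linf_intros Linf_integrand(1)[OF P _ z] Linf_integrand(1)[OF P _ zb]
    Linf_traj_at[OF z] Linf_traj_at[OF zb] Linf_integrand(2)[OF P _ zb sel] integrands_memI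
  have int: "integrable ?M (\<lambda>t. ?G (?y t) t - ?H (?y t) t)"
    "integrable ?M (\<lambda>t. ?G (?yb t) t - ?H (?yb t) t)"
    "integrable ?M (\<lambda>t. (norm (?y t - ?yb t))\<^sup>2)"
    "integrable ?M (\<lambda>t. ?G (?y t) t - V0_of V t \<bullet> ?y t)"
    "integrable ?M (\<lambda>t. ?G (?yb t) t - V0_of V t \<bullet> ?yb t)"
    by (intro Linf_imp_integrable Linfs)+
  \<comment> \<open>In this arrangement the \<open>G\<^sub>0\<close> terms cancel, leaving precisely
    the strengthened subgradient inequality for \<open>H\<^sub>0\<close>.\<close>
  have "(LINT t|?M. ((?G (?y t) t - ?H (?y t) t) - (?G (?yb t) t - ?H (?yb t) t))
        + \<mu> / 2 * (norm (?y t - ?yb t))\<^sup>2)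
      \<le> (LINT t|?M. (?G (?y t) t - V0_of V t \<bullet> ?y t) - (?G (?yb t) t - V0_of V t \<bullet> ?yb t))"
  proof (rule integral_mono_AE)
    have "AE t in ?M. V0_of V t \<in> subdiff (\<lambda>y. ?H y t) (?yb t)"
      using sel by (simp add: measurable_selection_def)
    with sc show "AE t in ?M. ((?G (?y t) t - ?H (?y t) t) - (?G (?yb t) t - ?H (?yb t) t))
        + \<mu> / 2 * (norm (?y t - ?yb t))\<^sup>2
      \<le> (?G (?y t) t - V0_of V t \<bullet> ?y t) - (?G (?yb t) t - V0_of V t \<bullet> ?yb t)"
    proof eventually_elim
      case (elim t)
      from strongly_convex_subdiff_ge[OF this, of "?y t"] show ?case
        by (simp add: inner_diff_right)
    qed
  qed (use int in \<open>auto intro!: Bochner_Integration.integrable_add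
      Bochner_Integration.integrable_diff integrable_mult_right\<close>)
  moreover have "v_of V 0 \<in> subdiff (h_of P 0) ?bb"
    using V by (simp add: subgrad_collection_def)
  note subdiff_ge[OF this, of ?b]
  ultimately show ?thesis
    using int unfolding costJ_def omg_def traj_L2_norm_power2 f_of_def
    by (simp add: inner_diff_right)
qed

text \<open>The change of the penalty function plus the gap is at most the change of
  \<open>majQ\<close>, since \<open>Gam\<close> dominates at \<open>z\<close> and is exact at
  \<open>zb\<close>; the latter change is nonpositive by assumption.\<close>

lemma penalty_Phi_decrease:
  assumes "dc_data_assumptions P" "subgrad_collection P zb V"
    and "zb \<in> spaceX (T_of P)" "z \<in> spaceX (T_of P)"
    and "AE t in lebesgue_on {0..T_of P}. strongly_convex \<mu> (\<lambda>y. H0_of P y t)"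
    and "c \<ge> 0" "majQ P c zb V z \<le> majQ P c zb V zb"
  shows "penalty_Phi P c z + \<mu> / 2 * (traj_L2_norm (T_of P) (traj_diff z zb))\<^sup>2
    \<le> penalty_Phi P c zb"
proof -
  have "c * penalty_phi P z \<le> c * Gam P zb V z"
    using penalty_phi_le_Gam[OF assms(1-4)] \<open>c \<ge> 0\<close> by (rule mult_left_mono)
  then show ?thesis
    using costJ_le_omg[OF assms(1-5)] assms(7)
    unfolding penalty_Phi_def majQ_def Gam_self by linarith
qed

section \<open>Penalty parameters\<close>

text \<open>The test \<open>ok\<close> is arbitrary, so every loop of the method is covered at once.
  Admissibility of the current point is the loop invariant, and a single raise already yields the
  gap \<open>\<kappa>\<close>.\<close>

lemma raise_loop_result:
  assumes "raise_loop \<kappa> computed ok c c'" "computed c" "\<kappa> > 0"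
  shows "computed c' \<and> (c' = c \<or> c' \<ge> c + \<kappa>)"
  using assms by (induction rule: raise_loop.induct) auto

lemma penalty_steps_result:
  assumes "penalty_steps P B \<kappa> \<epsilon> zk V S ck cn" "\<kappa> > 0"
  shows "computed_point P \<epsilon> zk V S cn \<and> (cn = ck \<or> cn \<ge> ck + \<kappa>)"
proof -
  \<comment> \<open>All branches before the last loop reduce to two cases: the parameter is kept, or
    it results from one loop with some test.\<close>
  from assms(1) obtain cp ok where c: "computed_point P \<epsilon> zk V S ck"
    and "cp = ck \<or> (\<exists>ok. raise_loop \<kappa> (computed_point P \<epsilon> zk V S) ok ck cp)"
    and cn: "raise_loop \<kappa> (computed_point P \<epsilon> zk V S) ok cp cn"
    unfolding penalty_steps_def Let_def by (metis (no_types, lifting))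
  then have "computed_point P \<epsilon> zk V S cp \<and> (cp = ck \<or> cp \<ge> ck + \<kappa>)"
    using raise_loop_result[where computed = "computed_point P \<epsilon> zk V S", OF _ c \<open>\<kappa> > 0\<close>]
    by blast
  with raise_loop_result[OF cn] \<open>\<kappa> > 0\<close> show ?thesis by force
qed

text \<open>A bounded increasing sequence converges, so its increments tend to 0 and finally drop
  below \<open>\<kappa>\<close>; from then on an increment can only be 0.\<close>

lemma bounded_jumps_eventually_const:
  fixes c :: "nat \<Rightarrow> real"
  assumes bdd: "bounded (range c)" and "\<kappa> > 0"
    and jump: "\<And>k. c (Suc k) = c k \<or> c (Suc k) \<ge> c k + \<kappa>"
  obtains K where "\<And>k. k \<ge> K \<Longrightarrow> c k = c K"
proof -
  have "incseq c"
  proof (rule incseq_SucI)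
    fix k
    show "c k \<le> c (Suc k)" using jump[of k] \<open>\<kappa> > 0\<close> by linarith
  qed
  then have "convergent c"
    using bdd by (intro Bseq_monoseq_convergent) (auto simp: Bseq_eq_bounded monoseq_def incseq_def)
  then obtain L where "c \<longlonglongrightarrow> L"
    by (auto simp: convergent_def)
  from tendsto_diff[OF LIMSEQ_Suc[OF this] this] have "(\<lambda>k. c (Suc k) - c k) \<longlonglongrightarrow> 0"
    by simp
  then have "eventually (\<lambda>k. c (Suc k) - c k < \<kappa>) sequentially"
    using \<open>\<kappa> > 0\<close> by (rule order_tendstoD(2))
  then obtain K where K: "\<And>k. k \<ge> K \<Longrightarrow> c (Suc k) - c k < \<kappa>"
    by (auto simp: eventually_sequentially)
  have "c k = c K" if "k \<ge> K" for k
    using that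
  proof (induction k rule: dec_induct)
    case (step k)
    then show ?case using jump[of k] K[of k] by auto
  qed simp
  then show ?thesis by (rule that)
qed

text \<open>Telescoping from \<open>K\<close> bounds the partial sums of \<open>a\<close> by the
  total drop of \<open>b\<close> plus the sum of the errors. Shifting by \<open>K\<close> changes
  summability of neither series.\<close>

lemma summable_of_quasi_decrease:
  fixes a b \<nu> :: "nat \<Rightarrow> real"
  assumes "summable \<nu>" "\<And>k. 0 \<le> \<nu> k" "\<And>k. 0 \<le> a k" "bdd_below (b ` {K..})"
    and step: "\<And>k. k \<ge> K \<Longrightarrow> b (Suc k) + a k \<le> b k + \<nu> k"
  shows "summable a"
proof -
  obtain L where L: "\<And>k. k \<ge> K \<Longrightarrow> L \<le> b k"
    using assms(4) by (auto simp: bdd_below_def)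
  have telescope: "b (K + n) + (\<Sum>k<n. a (k + K)) \<le> b K + (\<Sum>k<n. \<nu> (k + K))" for n
  proof (induction n)
    case (Suc n)
    then show ?case using step[of "K + n"] by (simp add: add.commute)
  qed simp
  have "(\<Sum>k<n. a (k + K)) \<le> b K + (\<Sum>k. \<nu> (k + K)) - L" for n
  proof -
    have "(\<Sum>k<n. \<nu> (k + K)) \<le> (\<Sum>k. \<nu> (k + K))"
      using assms(1,2) by (intro sum_le_suminf) (auto intro: summable_ignore_initial_segment)
    then show ?thesis using telescope[of n] L[of "K + n"] by simp
  qed
  then have "summable (\<lambda>k. a (k + K))"
    using assms(3) by (intro summableI_nonneg_bounded)
  then show ?thesis by (simp add: summable_iff_shift)
qed

section \<open>Convergence\<close>

lemma L2_norm_le_traj_L2_norm: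
  assumes "z \<in> spaceX T" "w \<in> spaceX T"
  shows "L2_norm T (\<lambda>t. fst z t - fst w t) \<le> traj_L2_norm T (traj_diff z w)"
    and "L2_norm T (\<lambda>t. snd z t - snd w t) \<le> traj_L2_norm T (traj_diff z w)"
proof -
  have "Linf T (fst z)" "Linf T (snd z)" "Linf T (fst w)" "Linf T (snd w)"
    using assms unfolding spaceX_def W1inf_def
    by (auto intro: continuous_on_imp_Linf abs_continuous_on_interval_imp_continuous_on)
  then have int: "integrable (lebesgue_on {0..T}) (\<lambda>t. (norm (fst z t - fst w t))\<^sup>2)"
    "integrable (lebesgue_on {0..T}) (\<lambda>t. (norm (snd z t - snd w t))\<^sup>2)"
    by (auto intro!: Linf_imp_integrable Linf_norm_power2 Linf_diff)
  show "L2_norm T (\<lambda>t. fst z t - fst w t) \<le> traj_L2_norm T (traj_diff z w)"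
    "L2_norm T (\<lambda>t. snd z t - snd w t) \<le> traj_L2_norm T (traj_diff z w)"
    unfolding L2_norm_def traj_L2_norm_def fst_conv snd_conv
    by (intro real_sqrt_le_mono integral_mono int Bochner_Integration.integrable_add; simp)+
qed

lemma tendsto_zero_of_summable_power2:
  fixes a b :: "nat \<Rightarrow> real"
  assumes "summable (\<lambda>k. (a k)\<^sup>2)" "\<And>k. 0 \<le> b k" "\<And>k. b k \<le> a k"
  shows "b \<longlonglongrightarrow> 0"
proof -
  have "(\<lambda>k. sqrt ((a k)\<^sup>2)) \<longlonglongrightarrow> sqrt 0"
    by (intro tendsto_real_sqrt summable_LIMSEQ_zero assms(1))
  then have "a \<longlonglongrightarrow> 0"
    by (simp add: tendsto_rabs_zero_iff)
  then show ?thesis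
    by (rule tendsto_sandwich[OF _ _ tendsto_const, rotated 2]) (use assms in auto)
qed

theorem theorem3:
  fixes P :: "('n::finite, 'm::finite) dc_problem"
    and B :: bstep_params
    and \<kappa> \<mu> :: real
    and \<epsilon> \<nu> \<alpha>bar c :: "nat \<Rightarrow> real"
    and V :: "nat \<Rightarrow> ('n, 'm) subgrads"
    and S :: "nat \<Rightarrow> real \<Rightarrow> ('n, 'm) traj"
    and x :: "nat \<Rightarrow> real \<Rightarrow> real^'n"
    and u :: "nat \<Rightarrow> real \<Rightarrow> real^'m"
  assumes "dc_data_assumptions P"
    and "bstep_dca_run P B \<kappa> \<epsilon> \<nu> \<alpha>bar V S (\<lambda>k. (x k, u k)) c"
    and "bounded (range c)"
    and "summable \<nu>"
    and "\<mu> > 0"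
    and "AE t in lebesgue_on {0..T_of P}. strongly_convex \<mu> (\<lambda>y. H0_of P y t)"
  shows "summable (\<lambda>k. (traj_L2_norm (T_of P)
             ((\<lambda>t. x (Suc k) t - x k t), (\<lambda>t. u (Suc k) t - u k t)))\<^sup>2) \<and>
         (\<lambda>k. L2_norm (T_of P) (\<lambda>t. x (Suc k) t - x k t)) \<longlonglongrightarrow> 0 \<and>
         (\<lambda>k. L2_norm (T_of P) (\<lambda>t. u (Suc k) t - u k t)) \<longlonglongrightarrow> 0"
proof -
  let ?T = "T_of P"
  define z where "z = (\<lambda>k. (x k, u k))"
  \<comment> \<open>\<open>w k\<close> is the point computed for the final parameter of iteration
    \<open>k\<close>, where the line search starts; \<open>M\<close> measures the way to it and
    \<open>N\<close> the whole step.\<close>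
  define w where "w = (\<lambda>k. S k (c (Suc k)))"
  define N where "N = (\<lambda>k. (traj_L2_norm ?T (traj_diff (z (Suc k)) (z k)))\<^sup>2)"
  define M where "M = (\<lambda>k. (traj_L2_norm ?T (traj_diff (w k) (z k)))\<^sup>2)"
  note run = assms(2)[unfolded bstep_dca_run_def, folded z_def]
  have "\<kappa> > 0" and c0: "c 0 > 0" and bdd: "bdd_below (penalty_Phi P (c 0) ` X0_of P)"
    and sub: "\<And>k. subgrad_collection P (z k) (V k)"
    and pen: "\<And>k. penalty_steps P B \<kappa> (\<epsilon> k) (z k) (V k) (S k) (c k) (c (Suc k))"
    and line: "\<And>k. line_search_step P B (\<nu> k) (\<alpha>bar k) (c (Suc k)) (z k) (w k) (z (Suc k))"
    and "sigma B > 0"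
    using run by (auto simp: w_def valid_params_def z_def)
  have X0: "X0_of P \<subseteq> spaceX ?T"
    using assms(1) by (simp add: dc_data_assumptions_def)
  have \<nu>: "\<nu> k \<ge> 0" for k
    using line[of k] by (simp add: line_search_step_def Let_def)
  have zX0: "z k \<in> X0_of P" for k
  proof (cases k)
    case 0
    then show ?thesis using run by (simp add: z_def)
  next
    case (Suc j)
    then show ?thesis using line[of j] by (auto simp: line_search_step_def Let_def)
  qed
  have comp: "computed_point P (\<epsilon> k) (z k) (V k) (S k) (c (Suc k))"
    and jump: "c (Suc k) = c k \<or> c (Suc k) \<ge> c k + \<kappa>" for k
    using penalty_steps_result[OF pen \<open>\<kappa> > 0\<close>] by auto
  have wX0: "w k \<in> X0_of P" and wQ: "majQ P (c (Suc k)) (z k) (V k) (w k)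
      \<le> majQ P (c (Suc k)) (z k) (V k) (z k)" for k
    using comp[of k] by (auto simp: computed_point_def eps_optimal_def w_def)
  have c_ge: "c 0 \<le> c k" for k
  proof (induction k)
    case (Suc k)
    then show ?case using jump[of k] \<open>\<kappa> > 0\<close> by linarith
  qed simp
  \<comment> \<open>The estimate
    \<open>(1 + \<alpha>)\<^sup>2 \<le> 2 * (1 + \<alpha>\<^sup>2)\<close> below costs a factor 2,
    so \<open>2 * \<rho>\<close> must not exceed either decrease coefficient,
    \<open>\<mu> / 2\<close> or \<open>sigma B\<close>.\<close>
  define \<rho> where "\<rho> = min (\<mu> / 2) (sigma B) / 2"
  have "\<rho> > 0" using \<open>\<mu> > 0\<close> \<open>sigma B > 0\<close> by (simp add: \<rho>_def)
  have decrease: "penalty_Phi P (c (Suc k)) (z (Suc k)) + \<rho> * N k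
      \<le> penalty_Phi P (c (Suc k)) (z k) + \<nu> k" for k
  proof -
    have "penalty_Phi P (c (Suc k)) (w k) + \<mu> / 2 * M k \<le> penalty_Phi P (c (Suc k)) (z k)"
      unfolding M_def
      using assms(1,6) sub zX0 wX0 X0 wQ c0 c_ge[of "Suc k"]
      by (intro penalty_Phi_decrease) auto
    moreover obtain \<alpha> where zn: "z (Suc k) = traj_lin 1 (w k) \<alpha> (traj_diff (w k) (z k))"
      and "penalty_Phi P (c (Suc k)) (z (Suc k)) - penalty_Phi P (c (Suc k)) (w k)
        \<le> - sigma B * \<alpha>\<^sup>2 * M k + \<nu> k"
      using line[of k] unfolding line_search_step_def Let_def M_def by (elim conjE exE) simp
    moreover have "\<rho> * N k \<le> \<mu> / 2 * M k + sigma B * \<alpha>\<^sup>2 * M k"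
    proof -
      \<comment> \<open>The line search continues beyond \<open>w k\<close> in the direction from
        \<open>z k\<close> to \<open>w k\<close>, so the whole step is this direction scaled by
        \<open>1 + \<alpha>\<close>.\<close>
      have "traj_at (z (Suc k)) t - traj_at (z k) t
          = (1 + \<alpha>) *\<^sub>R (traj_at (w k) t - traj_at (z k) t)" for t
        by (simp add: zn traj_at_def algebra_simps)
      then have "N k = (1 + \<alpha>)\<^sup>2 * M k"
        by (simp add: N_def M_def traj_L2_norm_power2 power_mult_distrib)
      moreover have "(1 + \<alpha>)\<^sup>2 \<le> 2 * (1 + \<alpha>\<^sup>2)"
        using zero_le_power2[of "1 - \<alpha>"] by (simp add: power2_eq_square algebra_simps)
      moreover have "M k \<ge> 0" by (simp add: M_def)
      ultimately have "N k \<le> 2 * (1 + \<alpha>\<^sup>2) * M k"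
        by (simp add: mult_right_mono)
      then have "\<rho> * N k \<le> \<rho> * (2 * (1 + \<alpha>\<^sup>2) * M k)"
        using \<open>\<rho> > 0\<close> by (intro mult_left_mono) auto
      also have "\<dots> = 2 * \<rho> * M k + 2 * \<rho> * (\<alpha>\<^sup>2 * M k)"
        by (simp add: algebra_simps)
      also have "\<dots> \<le> \<mu> / 2 * M k + sigma B * (\<alpha>\<^sup>2 * M k)"
        using \<open>M k \<ge> 0\<close> by (intro add_mono mult_right_mono) (auto simp: \<rho>_def)
      finally show ?thesis by (simp add: mult.assoc)
    qed
    ultimately show ?thesis by linarith
  qed
  obtain K where K: "\<And>k. k \<ge> K \<Longrightarrow> c k = c K"
    using bounded_jumps_eventually_const[OF assms(3) \<open>\<kappa> > 0\<close> jump] by blast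
  \<comment> \<open>Lower boundedness passes from parameter \<open>c 0\<close> to
    \<open>c K\<close>, because the parameters never decrease and the penalty term is
    nonnegative.\<close>
  have "bdd_below ((\<lambda>k. penalty_Phi P (c K) (z k)) ` {K..})"
  proof -
    obtain L where L: "\<And>y. y \<in> X0_of P \<Longrightarrow> L \<le> penalty_Phi P (c 0) y"
      using bdd by (auto simp: bdd_below_def)
    have "L \<le> penalty_Phi P (c K) (z k)" for k
    proof -
      have "c 0 * penalty_phi P (z k) \<le> c K * penalty_phi P (z k)"
        using c_ge penalty_phi_nonneg by (rule mult_right_mono)
      then show ?thesis using L[OF zX0[of k]] by (simp add: penalty_Phi_def)
    qed
    then show ?thesis by (rule bdd_belowI2)
  qed
  \<comment> \<open>The decrease of iteration \<open>k\<close> is measured at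
    \<open>c (Suc k)\<close>, which equals \<open>c K\<close> here; hence all these decrements
    concern one function and can be telescoped.\<close>
  moreover have "penalty_Phi P (c K) (z (Suc k)) + \<rho> * N k \<le> penalty_Phi P (c K) (z k) + \<nu> k"
    if "k \<ge> K" for k
    using decrease[of k] K[of "Suc k"] that by simp
  moreover have "0 \<le> \<rho> * N k" for k
    using \<open>\<rho> > 0\<close> by (simp add: N_def)
  ultimately have "summable (\<lambda>k. \<rho> * N k)"
    by (intro summable_of_quasi_decrease[OF assms(4) \<nu>])
  then have "summable N"
    using \<open>\<rho> > 0\<close> by (simp add: summable_cmult_iff)
  moreover have "L2_norm ?T f \<ge> 0" for f :: "real \<Rightarrow> 'b::euclidean_space"
    by (simp add: L2_norm_def)
  moreover note L2_norm_le_traj_L2_norm[OF subsetD[OF X0 zX0] subsetD[OF X0 zX0]]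
  ultimately have
    "(\<lambda>k. L2_norm ?T (\<lambda>t. fst (z (Suc k)) t - fst (z k) t)) \<longlonglongrightarrow> 0"
    "(\<lambda>k. L2_norm ?T (\<lambda>t. snd (z (Suc k)) t - snd (z k) t)) \<longlonglongrightarrow> 0"
    unfolding N_def by - (rule tendsto_zero_of_summable_power2, assumption+)+
  with \<open>summable N\<close> show ?thesis
    by (simp add: N_def z_def)
qed

end
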